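(* Let $k\geq 2$ and let $\mathcal{F}\subset\binom{[n]}{k}$ be an intersecting family. If $\gamma(\mathcal{F})=(1-\alpha)\binom{n-3}{k-2}$ with $0\leq\alpha<1$ and $n\geq\max\{k+4,40\}\cdot\frac{k}{1-\alpha}$, then there exist distinct $u,v,w\in[n]$ such that $\mathcal{F}\subset\mathcal{F}_{uvw}^*$ and \[ |\mathcal{F}_{uvw}\setminus\mathcal{F}|\leq 3\alpha\binom{n-3}{k-2}. \]
   Context: $[n]=\{1,\ldots,n\}$ and $\binom{[n]}{k}$ is the collection of all $k$-element subsets of $[n]$. A family $\mathcal{F}\subset\binom{[n]}{k}$ is intersecting if $F\cap F'\neq\emptyset$ for all $F,F'\in\mathcal{F}$. For $x\in[n]$, $\mathcal{F}(x)=\{F\setminus\{x\}\colon x\in F\in\mathcal{F}\}$; $\Delta(\mathcal{F})=\max_{1\leq x\leq n}|\mathcal{F}(x)|$ is the maximum degree, and $\gamma(\mathcal{F})=|\mathcal{F}|-\Delta(\mathcal{F})$ is the diversity. For a 3-element set $\{u,v,w\}\subset[n]$, \[ \mathcal{F}_{uvw}=\left\{F\in\binom{[n]}{k}\colon |F\cap\{u,v,w\}|=2\right\},\quad \mathcal{F}_{uvw}^*=\left\{F\in\binom{[n]}{k}\colon |F\cap\{u,v,w\}|\geq 2\right\}. \] *)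

theory Defs
  imports Complex_Main "HOL-Library.Ramsey"
begin

text \<open>
  The ground set is \<open>{1..n}\<close>; the collection of its \<open>k\<close>-element subsets is
  \<^term>\<open>[{1..n}]\<^bsup>k\<^esup>\<close> (\<^const>\<open>nsets\<close>).
\<close>

definition intersecting :: "nat set set \<Rightarrow> bool" where
  "intersecting \<F> \<longleftrightarrow> (\<forall>F\<in>\<F>. \<forall>F'\<in>\<F>. F \<inter> F' \<noteq> {})"

definition link :: "nat set set \<Rightarrow> nat \<Rightarrow> nat set set" where
  "link \<F> x = {F - {x} | F. x \<in> F \<and> F \<in> \<F>}"

text \<open>Only meaningful for \<open>n \<ge> 1\<close>, as otherwise the maximum ranges over the empty set.\<close>

definition max_degree :: "nat \<Rightarrow> nat set set \<Rightarrow> nat" where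
  "max_degree n \<F> = Max ((\<lambda>x. card (link \<F> x)) ` {1..n})"

definition diversity :: "nat \<Rightarrow> nat set set \<Rightarrow> int" where
  "diversity n \<F> = int (card \<F>) - int (max_degree n \<F>)"

definition two_of_three :: "nat \<Rightarrow> nat \<Rightarrow> nat \<Rightarrow> nat \<Rightarrow> nat \<Rightarrow> nat set set" where
  "two_of_three n k u v w = {F \<in> [{1..n}]\<^bsup>k\<^esup>. card (F \<inter> {u, v, w}) = 2}"

definition two_of_three_star :: "nat \<Rightarrow> nat \<Rightarrow> nat \<Rightarrow> nat \<Rightarrow> nat \<Rightarrow> nat set set" where
  "two_of_three_star n k u v w = {F \<in> [{1..n}]\<^bsup>k\<^esup>. card (F \<inter> {u, v, w}) \<ge> 2}"

end

theory Submission
  imports Defs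
begin

text \<open>
  Call an intersecting family critical if no member can be replaced by a proper subset without
  destroying the intersection property. In a critical family with members of size at most \<open>s\<close>,
  branching over disjoint members shows that at most \<open>s ^ s\<close> members have size exactly \<open>s\<close>.
  Starting with \<open>\<F>\<close>, one alternately passes to a critical family of subsets and discards its
  largest members, for \<open>s = k, k - 1, \<dots>, 3\<close>. The sets of \<open>\<F>\<close> lost in this way are few: among
  those avoiding a fixed point there are at most \<open>\<Sum>s. s ^ s * ((n - 1 - s) choose (k - s))\<close>.
  What is left is an intersecting family of sets of size at most two, so a star or a triangle.
  The centre of a star would be avoided by too few members of \<open>\<F>\<close>. For a triangle \<open>u, v, w\<close>,
  suppose \<open>G \<in> \<F>\<close> misses \<open>u\<close> and \<open>v\<close>. The members of \<open>\<F>\<close> avoiding \<open>w\<close> either contain \<open>u\<close>, \<open>v\<close> and a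
  point of \<open>G\<close>, or were lost at some stage \<open>s \<ge> 4\<close>, and again they are too few.
\<close>

section \<open>Critical families\<close>

definition critical :: "nat set set \<Rightarrow> bool" where
  "critical B \<longleftrightarrow> (\<forall>b\<in>B. \<forall>S. S \<subset> b \<longrightarrow> (\<exists>c\<in>B. c \<inter> S = {}))"

text \<open>Among the intersecting families of subsets of \<open>V\<close> in which every member of
  \<open>T\<close> contains a member, take one of least weight \<open>f\<close>. Shrinking or
  deleting a member lowers the weight, so minimality gives criticality and, for each
  \<open>b\<close>, a witness \<open>t\<close> containing no other member. That witness later
  isolates the edges of the triangle.\<close>

lemma critical_reduction:
  assumes "finite V" "T \<subseteq> Pow V" "intersecting T"
  obtains B where "B \<subseteq> Pow V" "intersecting B" "critical B" "\<And>t. t \<in> T \<Longrightarrow> \<exists>b\<in>B. b \<subseteq> t"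
    "\<And>b. b \<in> B \<Longrightarrow> \<exists>t\<in>T. b \<subseteq> t \<and> (\<forall>b'\<in>B. b' \<subseteq> t \<longrightarrow> b' = b)"
proof -
  define P where "P B \<longleftrightarrow> B \<subseteq> Pow V \<and> intersecting B \<and> (\<forall>t\<in>T. \<exists>b\<in>B. b \<subseteq> t)" for B
  \<comment> \<open>The \<open>Suc\<close> makes every deletion lower the weight strictly, whatever
    the size of the deleted set.\<close>
  define f where "f B = (\<Sum>b\<in>B. Suc (card b))" for B :: "nat set set"
  have "P T"
    using assms by (auto simp: P_def)
  then obtain B where B: "P B" and least: "\<And>C. P C \<Longrightarrow> f B \<le> f C"
    using ex_has_least_nat[of P T f] by blast
  have fin: "finite B" "\<And>b. b \<in> B \<Longrightarrow> finite b"
    using B assms(1) by (auto simp: P_def intro: finite_subset dest: finite_subset[of B "Pow V"])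
  have f_remove: "f B = Suc (card b) + f (B - {b})" if "b \<in> B" for b
    unfolding f_def using fin(1) that by (rule sum.remove)
  have "critical B"
    unfolding critical_def
  proof (intro ballI allI impI)
    fix b S assume b: "b \<in> B" and S: "S \<subset> b"
    show "\<exists>c\<in>B. c \<inter> S = {}"
    proof (rule ccontr)
      assume meets: "\<not> (\<exists>c\<in>B. c \<inter> S = {})"
      with b S have "S \<noteq> {}" by blast
      have "P (insert S (B - {b}))"
        unfolding P_def
      proof (intro conjI ballI)
        show "insert S (B - {b}) \<subseteq> Pow V"
          using B b S by (auto simp: P_def)
        show "intersecting (insert S (B - {b}))"
          using B meets \<open>S \<noteq> {}\<close> unfolding P_def intersecting_def by (auto simp: Int_commute)
        fix t assume "t \<in> T"
        then obtain b' where "b' \<in> B" "b' \<subseteq> t"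
          using B by (auto simp: P_def)
        then show "\<exists>b\<in>insert S (B - {b}). b \<subseteq> t"
          using S by (cases "b' = b") auto
      qed
      then have "f B \<le> f (insert S (B - {b}))"
        by (rule least)
      also have "\<dots> \<le> Suc (card S) + f (B - {b})"
        unfolding f_def using fin(1) by (cases "S \<in> B - {b}") (simp_all add: insert_absorb)
      also have "\<dots> < f B"
        using f_remove[OF b] psubset_card_mono[OF fin(2)[OF b] S] by simp
      finally show False by simp
    qed
  qed
  moreover have "\<exists>t\<in>T. b \<subseteq> t \<and> (\<forall>b'\<in>B. b' \<subseteq> t \<longrightarrow> b' = b)" if b: "b \<in> B" for b
  proof (rule ccontr)
    assume redundant: "\<not> ?thesis"
    have "P (B - {b})"
      unfolding P_def
    proof (intro conjI ballI)
      show "B - {b} \<subseteq> Pow V" "intersecting (B - {b})"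
        using B by (auto simp: P_def intersecting_def)
      fix t assume t: "t \<in> T"
      then obtain b' where b': "b' \<in> B" "b' \<subseteq> t"
        using B by (auto simp: P_def)
      show "\<exists>b\<in>B - {b}. b \<subseteq> t"
      proof (cases "b' = b")
        case True
        then have "\<exists>b''\<in>B. b'' \<subseteq> t \<and> b'' \<noteq> b"
          using redundant t b' by simp
        then show ?thesis by auto
      qed (use b' in auto)
    qed
    from least[OF this] f_remove[OF b] show False by simp
  qed
  ultimately show thesis
    using that[of B] B by (auto simp: P_def)
qed

lemma card_UN_bound:
  assumes "finite I" "card I \<le> m" "\<And>i. i \<in> I \<Longrightarrow> card (A i) \<le> c"
  shows "card (\<Union>i\<in>I. A i) \<le> m * c"
proof -
  have "card (\<Union>i\<in>I. A i) \<le> (\<Sum>i\<in>I. card (A i))"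
    by (rule card_UN_le[OF assms(1)])
  also have "\<dots> \<le> card I * c"
    using sum_bounded_above[of I "\<lambda>i. card (A i)" c] assms(3) by simp
  also have "\<dots> \<le> m * c"
    using assms(2) by simp
  finally show ?thesis .
qed

text \<open>Branching: while \<open>S\<close> is a proper subset of a member, criticality supplies a
  member \<open>c\<close> disjoint from \<open>S\<close>, and every member must meet
  \<open>c\<close>. So \<open>S\<close> grows by one of at most \<open>s\<close> new points, and
  this happens \<open>s - card S\<close> times.\<close>

lemma card_critical_containing:
  assumes "finite B" "\<And>b. b \<in> B \<Longrightarrow> finite b" "\<And>b. b \<in> B \<Longrightarrow> card b \<le> s"
    "intersecting B" "critical B" "finite S" "card S \<le> s"
  shows "card {b\<in>B. card b = s \<and> S \<subseteq> b} \<le> s ^ (s - card S)"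
  using assms(6,7)
proof (induction "s - card S" arbitrary: S)
  case 0
  have "{b\<in>B. card b = s \<and> S \<subseteq> b} \<subseteq> {S}"
  proof (intro subsetI)
    fix b assume "b \<in> {b\<in>B. card b = s \<and> S \<subseteq> b}"
    with 0 assms(2) have "S = b" by (intro card_subset_eq) auto
    then show "b \<in> {S}" by simp
  qed
  then have "card {b\<in>B. card b = s \<and> S \<subseteq> b} \<le> card {S}"
    by (intro card_mono) auto
  with 0 show ?case by simp
next
  case (Suc d)
  show ?case
  proof (cases "{b\<in>B. card b = s \<and> S \<subseteq> b} = {}")
    case False
    then obtain b where "b \<in> B" "card b = s" "S \<subseteq> b" by auto
    with Suc.hyps(2) have "S \<subset> b" by auto
    with \<open>b \<in> B\<close> obtain c where c: "c \<in> B" "c \<inter> S = {}"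
      using \<open>critical B\<close> unfolding critical_def by blast
    have "{b\<in>B. card b = s \<and> S \<subseteq> b} \<subseteq> (\<Union>z\<in>c. {b\<in>B. card b = s \<and> insert z S \<subseteq> b})"
    proof
      fix b assume "b \<in> {b\<in>B. card b = s \<and> S \<subseteq> b}"
      moreover from this c(1) have "b \<inter> c \<noteq> {}"
        using \<open>intersecting B\<close> unfolding intersecting_def by blast
      ultimately show "b \<in> (\<Union>z\<in>c. {b\<in>B. card b = s \<and> insert z S \<subseteq> b})" by blast
    qed
    then have "card {b\<in>B. card b = s \<and> S \<subseteq> b}
        \<le> card (\<Union>z\<in>c. {b\<in>B. card b = s \<and> insert z S \<subseteq> b})"
      using assms(1,2) c(1) by (intro card_mono) auto
    also have "\<dots> \<le> s * s ^ d"
    proof (rule card_UN_bound)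
      fix z assume "z \<in> c"
      with c(2) have "z \<notin> S" by blast
      with Suc.prems(1) have "card (insert z S) = Suc (card S)" by simp
      with Suc.hyps(2) Suc.prems have "d = s - card (insert z S)" "card (insert z S) \<le> s" by auto
      with Suc.hyps(1)[of "insert z S"] Suc.prems(1)
      show "card {b\<in>B. card b = s \<and> insert z S \<subseteq> b} \<le> s ^ d" by auto
    qed (use assms(2,3) c(1) in auto)
    also have "\<dots> = s ^ (s - card S)"
      using Suc.hyps(2) by (metis power_Suc)
    finally show ?thesis .
  next
    case True
    then show ?thesis by (metis card.empty le0)
  qed
qed

text \<open>The first branching is over the given member \<open>c\<close>, so a small
  \<open>c\<close> replaces one factor \<open>s\<close> by \<open>card c\<close>. The triangle case
  needs this saving at size 5.\<close>

lemma card_critical_meeting: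
  assumes "finite B" "\<And>b. b \<in> B \<Longrightarrow> finite b" "\<And>b. b \<in> B \<Longrightarrow> card b \<le> s"
    "intersecting B" "critical B" "c \<in> B" "s \<ge> 1"
  shows "card {b\<in>B. card b = s} \<le> card c * s ^ (s - 1)"
proof -
  have "{b\<in>B. card b = s} \<subseteq> (\<Union>z\<in>c. {b\<in>B. card b = s \<and> {z} \<subseteq> b})"
    using assms(4,6) unfolding intersecting_def by blast
  then have "card {b\<in>B. card b = s} \<le> card (\<Union>z\<in>c. {b\<in>B. card b = s \<and> {z} \<subseteq> b})"
    using assms(1,2,6) by (intro card_mono) auto
  also have "\<dots> \<le> card c * s ^ (s - 1)"
    using card_critical_containing[OF assms(1-5), of "{_}"] assms(2,6,7)
    by (intro card_UN_bound) auto
  finally show ?thesis .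
qed

section \<open>Intersecting families of sets of size at most two\<close>

lemma intersecting_pairs:
  assumes "intersecting T" "\<forall>t\<in>T. finite t \<and> card t \<le> 2" "T \<noteq> {}"
  shows "(\<exists>x\<in>\<Union>T. \<forall>t\<in>T. x \<in> t) \<or>
    (\<exists>u v w. u \<noteq> v \<and> u \<noteq> w \<and> v \<noteq> w \<and> {u, v} \<in> T \<and> {u, w} \<in> T \<and> {v, w} \<in> T)"
proof -
  have pair: "\<exists>b. t = {a, b}" if "t \<in> T" "a \<in> t" for t a
  proof -
    have "card (t - {a}) \<le> 1"
      using bspec[OF assms(2) that(1)] card_Suc_Diff1[of t a] that(2) by simp
    then have "card (t - {a}) = 0 \<or> card (t - {a}) = 1" by linarith
    then show ?thesis
    proof
      \<comment> \<open>A singleton is treated as a degenerate pair.\<close>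
      assume "card (t - {a}) = 0"
      with bspec[OF assms(2) that(1)] that(2) have "t = {a, a}"
        by (metis Diff_eq_empty_iff card_0_eq finite_Diff insertE insert_absorb2 singletonI subset_singletonD empty_iff)
      then show ?thesis ..
    next
      assume "card (t - {a}) = 1"
      then obtain b where "t - {a} = {b}" by (auto simp: card_1_singleton_iff)
      with that(2) have "t = {a, b}" by auto
      then show ?thesis ..
    qed
  qed
  have meet: "t \<inter> t' \<noteq> {}" if "t \<in> T" "t' \<in> T" for t t'
    using assms(1) that unfolding intersecting_def by blast
  obtain t where t: "t \<in> T" using assms(3) by blast
  then obtain u where u: "u \<in> t" using meet[OF t t] by blast
  obtain v where v: "t = {u, v}" using pair[OF t u] by blast
  show ?thesis
  proof (cases "(\<forall>t\<in>T. u \<in> t) \<or> (\<forall>t\<in>T. v \<in> t)")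
    case True
    then show ?thesis using t v by blast
  next
    case False
    \<comment> \<open>A member missing \<open>u\<close> contains \<open>v\<close>, and a member
      missing \<open>v\<close> contains \<open>u\<close>; these two can meet only in a common third
      point.\<close>
    then obtain t1 t2 where t1: "t1 \<in> T" "u \<notin> t1" and t2: "t2 \<in> T" "v \<notin> t2" by blast
    have "v \<in> t1" using meet[OF t t1(1)] t1(2) v by auto
    then obtain w where w: "t1 = {v, w}" using pair t1(1) by blast
    have "u \<in> t2" using meet[OF t t2(1)] t2(2) v by auto
    then obtain w' where w': "t2 = {u, w'}" using pair t2(1) by blast
    have "w = w'" "u \<noteq> w" "v \<noteq> u" "v \<noteq> w'"
      using meet[OF t1(1) t2(1)] w w' t1(2) t2(2) by auto
    then show ?thesis using t t1(1) t2(1) v w w' by metis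
  qed
qed

section \<open>Counting extensions\<close>

text \<open>Counts the \<open>k\<close>-subsets of an \<open>n\<close>-set that contain a given
  \<open>s\<close>-set and avoid a given point outside it. For \<open>s > k\<close> truncated
  subtraction would give 1 instead of 0, hence the case distinction.\<close>

definition num_ext :: "nat \<Rightarrow> nat \<Rightarrow> nat \<Rightarrow> real" where
  "num_ext n k s = (if s \<le> k then real ((n - 1 - s) choose (k - s)) else 0)"

lemma num_ext_nonneg: "num_ext n k s \<ge> 0"
  by (simp add: num_ext_def)

lemma card_extensions:
  assumes "S \<subseteq> {1..n}" "x \<in> {1..n}"
  shows "real (card {F\<in>[{1..n}]\<^bsup>k\<^esup>. S \<subseteq> F \<and> x \<notin> F}) \<le> num_ext n k (card S)"
proof (cases "x \<in> S \<or> card S > k")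
  case True
  then have "{F\<in>[{1..n}]\<^bsup>k\<^esup>. S \<subseteq> F \<and> x \<notin> F} = {}"
    by (auto simp: nsets_def dest: card_mono)
  then show ?thesis by (metis card.empty num_ext_nonneg of_nat_0)
next
  case False
  have fin: "finite S" using assms(1) finite_subset by blast
  have "card {F\<in>[{1..n}]\<^bsup>k\<^esup>. S \<subseteq> F \<and> x \<notin> F} \<le> card ([{1..n} - insert x S]\<^bsup>(k - card S)\<^esup>)"
  proof (rule card_inj_on_le)
    show "inj_on (\<lambda>F. F - S) {F\<in>[{1..n}]\<^bsup>k\<^esup>. S \<subseteq> F \<and> x \<notin> F}"
      by (auto simp: inj_on_def)
    show "(\<lambda>F. F - S) ` {F\<in>[{1..n}]\<^bsup>k\<^esup>. S \<subseteq> F \<and> x \<notin> F} \<subseteq> [{1..n} - insert x S]\<^bsup>(k - card S)\<^esup>"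
      using fin by (auto simp: nsets_def card_Diff_subset)
    show "finite ([{1..n} - insert x S]\<^bsup>(k - card S)\<^esup>)"
      by (intro finite_imp_finite_nsets) auto
  qed
  also have "\<dots> = (n - 1 - card S) choose (k - card S)"
  proof -
    have "card ({1..n} - insert x S) = n - 1 - card S"
      using assms fin False by (subst card_Diff_subset) auto
    then show ?thesis by simp
  qed
  finally show ?thesis using False by (simp add: num_ext_def)
qed

section \<open>Decay of the extension counts with the size of the fixed set\<close>

lemma num_ext_Suc:
  assumes "s \<le> k" "k < n"
  shows "real (n - 1 - s) * num_ext n k (Suc s) = real (k - s) * num_ext n k s"
proof (cases "s = k")
  case False
  with assms obtain d where d: "k - s = Suc d" by (metis Suc_diff_Suc le_neq_implies_less)
  have "Suc d * ((n - 1 - s) choose Suc d) = (n - 1 - s) * ((n - 1 - s - 1) choose d)"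
    by (rule binomial_absorption)
  then have "real (Suc d) * real ((n - 1 - s) choose Suc d)
      = real (n - 1 - s) * real ((n - 1 - s - 1) choose d)"
    by (metis of_nat_mult)
  moreover have "k - Suc s = d" "Suc s \<le> k" using d by auto
  ultimately show ?thesis using d assms by (simp add: num_ext_def)
qed (simp add: num_ext_def)

lemma num_ext_Suc_le:
  assumes "k < n" "real (k - s) \<le> r * real (n - 1 - s)" "r \<ge> 0"
  shows "num_ext n k (Suc s) \<le> r * num_ext n k s"
proof (cases "s < k")
  case True
  then have pos: "real (n - 1 - s) > 0" using assms(1) by simp
  have "real (n - 1 - s) * num_ext n k (Suc s) = real (k - s) * num_ext n k s"
    using True assms(1) by (intro num_ext_Suc) auto
  also have "\<dots> \<le> (r * real (n - 1 - s)) * num_ext n k s"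
    using assms(2) num_ext_nonneg by (rule mult_right_mono)
  finally show ?thesis using pos by (simp add: mult.assoc mult.left_commute)
next
  case False
  then have "num_ext n k (Suc s) = 0" by (simp add: num_ext_def)
  then show ?thesis using assms(3) num_ext_nonneg[of n k s] by simp
qed

lemma num_ext_Suc_le_40:
  assumes "40 * k \<le> n" "k \<ge> 1" "s \<ge> 1"
  shows "num_ext n k (Suc s) \<le> num_ext n k s / 40"
proof -
  have "40 * (k - s) \<le> n - 1 - s" using assms by arith
  then have "real (k - s) \<le> 1/40 * real (n - 1 - s)" by linarith
  then show ?thesis using num_ext_Suc_le[of k n s "1/40"] assms by auto
qed

text \<open>Amounts to \<open>(1 + 1/s) ^ s \<le> exp 1 \<le> 3\<close>.\<close>

lemma Suc_power_self_le:
  assumes "s \<ge> 1"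
  shows "real (Suc s) ^ Suc s \<le> 3 * real (Suc s) * real s ^ s"
proof -
  have "(1 + 1 / real s) ^ s \<le> exp (1 / real s) ^ s"
    by (intro power_mono) (auto simp: exp_ge_add_one_self)
  also have "\<dots> = exp 1"
    using assms by (simp flip: exp_of_nat_mult)
  also have "\<dots> \<le> 3" by (rule exp_le)
  finally have "(1 + 1 / real s) ^ s * real s ^ s \<le> 3 * real s ^ s"
    by (intro mult_right_mono) auto
  moreover have "(1 + 1 / real s) ^ s * real s ^ s = real (Suc s) ^ s"
    using assms by (simp flip: power_mult_distrib add: distrib_right add.commute)
  ultimately have "real (Suc s) * real (Suc s) ^ s \<le> real (Suc s) * (3 * real s ^ s)"
    by (intro mult_left_mono) auto
  then show ?thesis by (simp only: power_Suc mult_ac)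
qed

text \<open>Passing from \<open>s\<close> to \<open>s + 1\<close> multiplies \<open>s ^ s\<close> by
  at most \<open>3 * (s + 1)\<close> and \<open>num_ext\<close> by at most
  \<open>1 / (4 * (s + 1))\<close>.\<close>

lemma weighted_num_ext_decay:
  assumes "k * (k + 4) \<le> n" "k \<ge> 2" "s \<ge> 1"
  shows "real (Suc s) ^ Suc s * num_ext n k (Suc s) \<le> 3/4 * (real s ^ s * num_ext n k s)"
proof -
  have "k < n"
  proof -
    have "k * 1 < k * (k + 4)" using assms(2) by (intro mult_strict_left_mono) auto
    then show ?thesis using assms(1) by linarith
  qed
  have "num_ext n k (Suc s) \<le> 1 / (4 * real (Suc s)) * num_ext n k s"
  proof (rule num_ext_Suc_le[OF \<open>k < n\<close>])
    show "real (k - s) \<le> 1 / (4 * real (Suc s)) * real (n - 1 - s)"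
    proof (cases "s < k")
      case True
      \<comment> \<open>AM-GM for \<open>s + 1\<close> and \<open>k - s\<close>, whose sum is
        \<open>k + 1\<close>. The excess of \<open>k * (k + 4)\<close> over
        \<open>(k + 1)\<^sup>2\<close> then absorbs the \<open>1 + s\<close> subtracted from
        \<open>n\<close>.\<close>
      have "0 \<le> (real k - 2 * real s - 1)\<^sup>2" by simp
      then have "4 * (real s + 1) * (real k - real s) \<le> (real k + 1)\<^sup>2"
        by (simp add: power2_eq_square algebra_simps)
      moreover have "real k * (real k + 4) \<le> real n"
        using assms(1) by (metis of_nat_add of_nat_le_iff of_nat_mult of_nat_numeral)
      ultimately have "4 * (real s + 1) * (real k - real s) \<le> real n - 1 - real s"
        using True assms(2) by (simp add: power2_eq_square algebra_simps)
      then show ?thesis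
        using True \<open>k < n\<close> by (simp add: field_simps of_nat_diff)
    qed auto
  qed simp
  then have "real (Suc s) ^ Suc s * num_ext n k (Suc s)
      \<le> (3 * real (Suc s) * real s ^ s) * (1 / (4 * real (Suc s)) * num_ext n k s)"
    using Suc_power_self_le[OF assms(3)] num_ext_nonneg by (intro mult_mono) auto
  also have "\<dots> = 3/4 * (real s ^ s * num_ext n k s)"
    by (simp add: field_simps)
  finally show ?thesis .
qed

lemma sum_weighted_num_ext_tail:
  assumes "k * (k + 4) \<le> n" "k \<ge> 2"
  shows "(\<Sum>s=8..8 + d. real s ^ s * num_ext n k s) \<le> 4 * 8 ^ 8 * num_ext n k 8"
proof -
  define f where "f s = real s ^ s * num_ext n k s" for s
  \<comment> \<open>The term \<open>3 * f (8 + d)\<close> is the total of a geometric tail of ratio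
    3/4 following \<open>f (8 + d)\<close>; including it makes the bound inductive.\<close>
  have "(\<Sum>s=8..8 + d. f s) + 3 * f (8 + d) \<le> 4 * f 8"
  proof (induction d)
    case (Suc d)
    have "f (8 + Suc d) \<le> 3/4 * f (8 + d)"
      using weighted_num_ext_decay[OF assms, of "8 + d"] by (simp add: f_def)
    moreover have "(\<Sum>s=8..8 + Suc d. f s) = (\<Sum>s=8..8 + d. f s) + f (8 + Suc d)"
      using sum.cl_ivl_Suc[of f 8 "8 + d"] by simp
    ultimately show ?case using Suc.IH by linarith
  qed simp
  moreover have "f (8 + d) \<ge> 0" by (simp add: f_def num_ext_nonneg)
  ultimately show ?thesis by (simp add: f_def)
qed

section \<open>Numerical bounds on the losses\<close>

lemma num_ext_2: "k \<ge> 2 \<Longrightarrow> num_ext n k 2 = real ((n - 3) choose (k - 2))"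
  by (simp add: num_ext_def numeral_eq_Suc)

text \<open>The first sum is the whole loss in peeling down to pairs and excludes a star. The second
  bounds the members avoiding a triangle vertex; there the coefficients 256 and 3125 of the general
  estimate are too large for this calculation, and 96 and 2500 come from the presence of the
  triangle.\<close>

lemma weighted_num_ext_bounds:
  fixes n k :: nat
  assumes "k \<ge> 2" "40 * k \<le> n" "k * (k + 4) \<le> n"
  defines "D \<equiv> num_ext n k" and "U \<equiv> real k / real n * real ((n - 3) choose (k - 2))"
  shows "(\<Sum>s=3..k + 8. real s ^ s * D s) < 40 * U"
    and "real k * D 3 + 96 * D 4 + 2500 * D 5 + (\<Sum>s=6..k + 8. real s ^ s * D s)
      < real (k + 4) * U"
proof -
  have "k < n" using assms by linarith
  have U: "U > 0" using assms \<open>k < n\<close> by (simp add: U_def)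
  have step: "D (Suc s) \<le> D s / 40" if "s \<ge> 1" for s
    unfolding D_def using assms that by (intro num_ext_Suc_le_40) auto
  \<comment> \<open>The ratio of \<open>D 3\<close> to \<open>D 2\<close> is
    \<open>(k - 2) / (n - 3)\<close>. Replacing \<open>n - 3\<close> by \<open>n\<close> costs at
    most 1/10 in the numerator because \<open>40 * k \<le> n\<close>. This leaves 59/10 of the
    allowance \<open>k + 4\<close> for the terms other than \<open>k * D 3\<close>.\<close>
  have "real (k - 2) \<le> (real k - 19/10) / real n * real (n - 1 - 2)"
  proof -
    have "40 * real k \<le> real n" using assms(2) by linarith
    moreover have "(real k - 19/10) * (real n - 3) - (real k - 2) * real n
        = real n / 10 - 3 * real k + 57/10"
      by (simp add: field_simps)
    ultimately have "(real k - 2) * real n \<le> (real k - 19/10) * (real n - 3)"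
      by linarith
    then show ?thesis
      using assms(1) \<open>k < n\<close> by (simp add: field_simps of_nat_diff)
  qed
  then have "D 3 \<le> (real k - 19/10) / real n * D 2"
    using num_ext_Suc_le[OF \<open>k < n\<close>, of 2 "(real k - 19/10) / real n"] assms(1)
    by (simp add: D_def)
  then have "real k * D 3 \<le> real k * ((real k - 19/10) / real n * D 2)"
    by (intro mult_left_mono) auto
  then have kD3: "real k * D 3 \<le> (real k - 19/10) * U"
    using assms(1) by (simp add: D_def U_def num_ext_2 mult_ac)
  also have "\<dots> \<le> real k * U"
    using U by (intro mult_right_mono) auto
  finally have D3: "D 3 \<le> U" using assms(1) by simp
  \<comment> \<open>Up to size 8 each further point gains a factor 40, and beyond that the geometric
    tail takes over. In units of \<open>D 3\<close> the totals are about 37.1 and, without the term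
    \<open>k * D 3\<close>, about 5.67.\<close>
  have D4: "D 4 \<le> D 3 / 40" and D5: "D 5 \<le> D 4 / 40" and D6: "D 6 \<le> D 5 / 40"
    and D7: "D 7 \<le> D 6 / 40" and D8: "D 8 \<le> D 7 / 40"
    using step[of 3] step[of 4] step[of 5] step[of 6] step[of 7] by simp_all
  have tail: "(\<Sum>s=8..k + 8. real s ^ s * D s) \<le> 67108864 * D 8"
    using sum_weighted_num_ext_tail[of k n k] assms by (simp add: D_def add.commute)
  have sum6: "(\<Sum>s=6..k + 8. real s ^ s * D s)
      = 46656 * D 6 + 823543 * D 7 + (\<Sum>s=8..k + 8. real s ^ s * D s)"
    by (simp add: sum.atLeast_Suc_atMost[of 6] sum.atLeast_Suc_atMost[of 7])
  have sum3: "(\<Sum>s=3..k + 8. real s ^ s * D s)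
      = 27 * D 3 + 256 * D 4 + 3125 * D 5 + (\<Sum>s=6..k + 8. real s ^ s * D s)"
    by (simp add: sum.atLeast_Suc_atMost[of 3] sum.atLeast_Suc_atMost[of 4]
        sum.atLeast_Suc_atMost[of 5])
  show "(\<Sum>s=3..k + 8. real s ^ s * D s) < 40 * U"
    unfolding sum3 sum6 using tail D3 D4 D5 D6 D7 D8 U by linarith
  have "96 * D 4 + 2500 * D 5 + (\<Sum>s=6..k + 8. real s ^ s * D s) \<le> 57/10 * U"
    unfolding sum6 using tail D3 D4 D5 D6 D7 D8 U by linarith
  with kD3 U show "real k * D 3 + 96 * D 4 + 2500 * D 5 + (\<Sum>s=6..k + 8. real s ^ s * D s)
      < real (k + 4) * U"
    by (simp add: algebra_simps)
qed

section \<open>Peeling\<close>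

text \<open>The members lost so far. Only those avoiding \<open>x\<close> are tracked, since the
  diversity bounds from below the number of members avoiding any given point.\<close>

definition uncovered :: "nat set set \<Rightarrow> nat set set \<Rightarrow> nat \<Rightarrow> nat set set" where
  "uncovered \<F> T x = {F\<in>\<F>. x \<notin> F \<and> \<not> (\<exists>t\<in>T. t \<subseteq> F)}"

lemma card_covered_le:
  assumes "\<F> \<subseteq> [{1..n}]\<^bsup>k\<^esup>" "W \<subseteq> Pow {1..n}" "\<And>w. w \<in> W \<Longrightarrow> card w = s" "card W \<le> m" "x \<in> {1..n}"
  shows "real (card {F\<in>\<F>. x \<notin> F \<and> (\<exists>w\<in>W. w \<subseteq> F)}) \<le> real m * num_ext n k s"
proof -
  have fin: "finite W" using assms(2) by (rule finite_subset) auto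
  have "finite ([{1..n}]\<^bsup>k\<^esup>)" by (intro finite_imp_finite_nsets) auto
  then have "card {F\<in>\<F>. x \<notin> F \<and> (\<exists>w\<in>W. w \<subseteq> F)}
      \<le> card (\<Union>w\<in>W. {F\<in>[{1..n}]\<^bsup>k\<^esup>. w \<subseteq> F \<and> x \<notin> F})"
    using fin assms(1) by (intro card_mono) auto
  also have "\<dots> \<le> (\<Sum>w\<in>W. card {F\<in>[{1..n}]\<^bsup>k\<^esup>. w \<subseteq> F \<and> x \<notin> F})"
    by (rule card_UN_le[OF fin])
  finally have "real (card {F\<in>\<F>. x \<notin> F \<and> (\<exists>w\<in>W. w \<subseteq> F)})
      \<le> (\<Sum>w\<in>W. real (card {F\<in>[{1..n}]\<^bsup>k\<^esup>. w \<subseteq> F \<and> x \<notin> F}))"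
    by (simp flip: of_nat_sum)
  also have "\<dots> \<le> (\<Sum>w\<in>W. num_ext n k s)"
  proof (rule sum_mono)
    fix w assume "w \<in> W"
    then show "real (card {F\<in>[{1..n}]\<^bsup>k\<^esup>. w \<subseteq> F \<and> x \<notin> F}) \<le> num_ext n k s"
      using card_extensions[of w n x k] assms(2,3,5) by auto
  qed
  also have "\<dots> \<le> real m * num_ext n k s"
    using assms(4) num_ext_nonneg by (simp add: mult_right_mono)
  finally show ?thesis .
qed

text \<open>Passing to the critical family loses nothing, as every \<open>t\<close> contains some
  \<open>b\<close>. Discarding the members of size \<open>s\<close> then loses only sets containing
  one of at most \<open>s ^ s\<close> of them.\<close>

lemma peel_step:
  assumes "\<F> \<subseteq> [{1..n}]\<^bsup>k\<^esup>" "T \<subseteq> Pow {1..n}" "intersecting T" "\<And>t. t \<in> T \<Longrightarrow> card t \<le> s"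
  obtains B where "B \<subseteq> Pow {1..n}" "intersecting B" "critical B" "\<And>t. t \<in> T \<Longrightarrow> \<exists>b\<in>B. b \<subseteq> t"
    "\<And>b. b \<in> B \<Longrightarrow> \<exists>t\<in>T. b \<subseteq> t \<and> (\<forall>b'\<in>B. b' \<subseteq> t \<longrightarrow> b' = b)" "\<And>b. b \<in> B \<Longrightarrow> card b \<le> s"
    "\<And>x. x \<in> {1..n} \<Longrightarrow> real (card (uncovered \<F> {b\<in>B. card b \<noteq> s} x))
      \<le> real (card (uncovered \<F> T x)) + real s ^ s * num_ext n k s"
proof -
  obtain B where B: "B \<subseteq> Pow {1..n}" "intersecting B" "critical B"
    and cover: "\<And>t. t \<in> T \<Longrightarrow> \<exists>b\<in>B. b \<subseteq> t"
    and needed: "\<And>b. b \<in> B \<Longrightarrow> \<exists>t\<in>T. b \<subseteq> t \<and> (\<forall>b'\<in>B. b' \<subseteq> t \<longrightarrow> b' = b)"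
    using critical_reduction[OF _ assms(2,3)] by blast
  have size: "card b \<le> s" if b: "b \<in> B" for b
  proof -
    obtain t where t: "t \<in> T" "b \<subseteq> t" using needed[OF b] by blast
    then have "finite t" using assms(2) finite_subset by blast
    then show ?thesis using card_mono[OF _ t(2)] assms(4)[OF t(1)] by linarith
  qed
  let ?W = "{b\<in>B. card b = s}"
  have finF: "finite \<F>"
    using assms(1) by (rule finite_subset) (auto intro: finite_imp_finite_nsets)
  have finB: "finite B" "\<And>b. b \<in> B \<Longrightarrow> finite b"
    using B(1) by (auto intro: finite_subset dest: finite_subset[of B "Pow {1..n}"])
  have "real (card (uncovered \<F> {b\<in>B. card b \<noteq> s} x))
      \<le> real (card (uncovered \<F> T x)) + real s ^ s * num_ext n k s" if x: "x \<in> {1..n}" for x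
  proof -
    have "uncovered \<F> {b\<in>B. card b \<noteq> s} x
        \<subseteq> uncovered \<F> T x \<union> {F\<in>\<F>. x \<notin> F \<and> (\<exists>w\<in>?W. w \<subseteq> F)}"
      using cover unfolding uncovered_def by (auto, meson subset_trans)
    then have "card (uncovered \<F> {b\<in>B. card b \<noteq> s} x)
        \<le> card (uncovered \<F> T x \<union> {F\<in>\<F>. x \<notin> F \<and> (\<exists>w\<in>?W. w \<subseteq> F)})"
      using finF by (intro card_mono) (auto simp: uncovered_def)
    also have "\<dots> \<le> card (uncovered \<F> T x) + card {F\<in>\<F>. x \<notin> F \<and> (\<exists>w\<in>?W. w \<subseteq> F)}"
      by (rule card_Un_le)
    finally have "real (card (uncovered \<F> {b\<in>B. card b \<noteq> s} x))
        \<le> real (card (uncovered \<F> T x)) + real (card {F\<in>\<F>. x \<notin> F \<and> (\<exists>w\<in>?W. w \<subseteq> F)})"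
      by linarith
    moreover have "card ?W \<le> s ^ s"
      using card_critical_containing[OF finB size B(2,3), of "{}"] by simp
    then have "real (card {F\<in>\<F>. x \<notin> F \<and> (\<exists>w\<in>?W. w \<subseteq> F)}) \<le> real (s ^ s) * num_ext n k s"
      using B(1) by (intro card_covered_le[OF assms(1) _ _ _ x]) auto
    ultimately show ?thesis by simp
  qed
  then show thesis
    by (intro that[OF B cover needed size])
qed

text \<open>Starting at size \<open>k + 8\<close> spares a case distinction on small \<open>k\<close>: the additional steps
  remove nothing and \<^const>\<open>num_ext\<close> vanishes there.\<close>

lemma peel:
  assumes "\<F> \<subseteq> [{1..n}]\<^bsup>k\<^esup>" "intersecting \<F>" "j \<le> k + 8"
  obtains T where "T \<subseteq> Pow {1..n}" "intersecting T" "\<And>t. t \<in> T \<Longrightarrow> card t \<le> j"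
    "\<And>x. x \<in> {1..n} \<Longrightarrow>
      real (card (uncovered \<F> T x)) \<le> (\<Sum>s=Suc j..k + 8. real s ^ s * num_ext n k s)"
proof -
  \<comment> \<open>The induction descends from \<open>k + 8\<close>, where \<F> itself serves as
    \<open>T\<close> with nothing lost.\<close>
  from assms(3) have "\<exists>T. T \<subseteq> Pow {1..n} \<and> intersecting T \<and> (\<forall>t\<in>T. card t \<le> j) \<and>
    (\<forall>x\<in>{1..n}.
      real (card (uncovered \<F> T x)) \<le> (\<Sum>s=Suc j..k + 8. real s ^ s * num_ext n k s))"
  proof (induction rule: inc_induct)
    case base
    have "uncovered \<F> \<F> x = {}" for x by (auto simp: uncovered_def)
    then show ?case
      using assms(1,2) by (intro exI[of _ \<F>]) (auto simp: nsets_def)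
  next
    case (step j)
    then obtain T where T: "T \<subseteq> Pow {1..n}" "intersecting T" "\<And>t. t \<in> T \<Longrightarrow> card t \<le> Suc j"
      and bound: "\<And>x. x \<in> {1..n} \<Longrightarrow>
        real (card (uncovered \<F> T x)) \<le> (\<Sum>s=Suc (Suc j)..k + 8. real s ^ s * num_ext n k s)"
      by blast
    obtain B where B: "B \<subseteq> Pow {1..n}" "intersecting B" "\<And>b. b \<in> B \<Longrightarrow> card b \<le> Suc j"
      "\<And>x. x \<in> {1..n} \<Longrightarrow> real (card (uncovered \<F> {b\<in>B. card b \<noteq> Suc j} x))
        \<le> real (card (uncovered \<F> T x)) + real (Suc j) ^ Suc j * num_ext n k (Suc j)"
      by (rule peel_step[OF assms(1) T(1,2), where s = "Suc j"]) (erule T(3), rule that)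
    have "(\<Sum>s=Suc j..k + 8. real s ^ s * num_ext n k s)
      = real (Suc j) ^ Suc j * num_ext n k (Suc j)
        + (\<Sum>s=Suc (Suc j)..k + 8. real s ^ s * num_ext n k s)"
      using step.hyps by (intro sum.atLeast_Suc_atMost) auto
    then have "real (card (uncovered \<F> {b\<in>B. card b \<noteq> Suc j} x))
        \<le> (\<Sum>s=Suc j..k + 8. real s ^ s * num_ext n k s)" if "x \<in> {1..n}" for x
      using B(4)[OF that] bound[OF that] by linarith
    moreover have "intersecting {b\<in>B. card b \<noteq> Suc j}"
      using B(2) unfolding intersecting_def by blast
    moreover have "\<forall>b\<in>{b\<in>B. card b \<noteq> Suc j}. card b \<le> j"
      using B(3) by force
    ultimately show ?case
      using B(1) by (intro exI[of _ "{b\<in>B. card b \<noteq> Suc j}"]) auto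
  qed
  then show thesis
    by (elim exE conjE) (rule that; auto)
qed

section \<open>The triangle case\<close>

lemma card_Int_three_ge_2_iff:
  assumes "u \<noteq> v" "u \<noteq> w" "v \<noteq> w"
  shows "card (F \<inter> {u, v, w}) \<ge> 2 \<longleftrightarrow> {u, v} \<subseteq> F \<or> {u, w} \<subseteq> F \<or> {v, w} \<subseteq> F"
  using assms by (cases "u \<in> F"; cases "v \<in> F"; cases "w \<in> F") (simp_all add: Int_insert_right)

text \<open>Each of \<open>a\<close>, \<open>b\<close>, \<open>c\<close> has at most one point
  beyond its pair. If \<open>W\<close> contains \<open>u\<close>, it misses \<open>v\<close> and
  \<open>w\<close> and meets \<open>c\<close> in its extra point, which leaves \<open>4 ^ 2\<close>
  choices; \<open>v\<close> and \<open>b\<close> behave likewise. Otherwise \<open>W\<close> misses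
  \<open>u\<close> and \<open>v\<close> and contains the extra point of \<open>a\<close>, with
  \<open>4 ^ 3\<close> choices: 16 + 16 + 64 = 96.\<close>

lemma card_critical_4_pair_free:
  assumes "finite B" "\<And>b. b \<in> B \<Longrightarrow> finite b" "\<And>b. b \<in> B \<Longrightarrow> card b \<le> 4"
    "intersecting B" "critical B"
    and "u \<noteq> v" "u \<noteq> w" "v \<noteq> w"
    and a: "a \<in> B" "card a \<le> 3" "{u, v} \<subseteq> a" "w \<notin> a"
    and b: "b \<in> B" "card b \<le> 3" "{u, w} \<subseteq> b" "v \<notin> b"
    and c: "c \<in> B" "card c \<le> 3" "{v, w} \<subseteq> c" "u \<notin> c"
  shows "card {W\<in>B. card W = 4 \<and> card (W \<inter> {u, v, w}) \<le> 1} \<le> 96"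
proof -
  define X where "X S = {W\<in>B. card W = 4 \<and> S \<subseteq> W}" for S
  have X: "card (X S) \<le> 4 ^ (4 - card S)" if "finite S" "card S \<le> 4" for S
    unfolding X_def by (rule card_critical_containing[OF assms(1-5) that])
  have fin: "finite a" "finite b" "finite c" using assms(2) a(1) b(1) c(1) by auto
  let ?A = "\<Union>z\<in>c - {v, w}. X {u, z}"
    and ?B = "\<Union>z\<in>b - {u, w}. X {v, z}" and ?C = "\<Union>z\<in>a - {u, v}. X {z}"
  have "{W\<in>B. card W = 4 \<and> card (W \<inter> {u, v, w}) \<le> 1} \<subseteq> ?A \<union> ?B \<union> ?C"
  proof
    fix W assume "W \<in> {W\<in>B. card W = 4 \<and> card (W \<inter> {u, v, w}) \<le> 1}"
    then have W: "W \<in> B" "card W = 4"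
      and free: "\<not> {u, v} \<subseteq> W" "\<not> {u, w} \<subseteq> W" "\<not> {v, w} \<subseteq> W"
      using card_Int_three_ge_2_iff[OF assms(6-8), of W] by auto
    have "W \<inter> a \<noteq> {}" "W \<inter> b \<noteq> {}" "W \<inter> c \<noteq> {}"
      using W(1) a(1) b(1) c(1) assms(4) unfolding intersecting_def by auto
    with W free show "W \<in> ?A \<union> ?B \<union> ?C"
      unfolding X_def by blast
  qed
  moreover have "finite (X S)" for S
    using assms(1) by (simp add: X_def)
  ultimately have "card {W\<in>B. card W = 4 \<and> card (W \<inter> {u, v, w}) \<le> 1} \<le> card (?A \<union> ?B \<union> ?C)"
    using fin by (intro card_mono) auto
  also have "\<dots> \<le> card ?A + card ?B + card ?C"
    by (meson add_right_mono card_Un_le le_trans)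
  also have "\<dots> \<le> 1 * 16 + 1 * 16 + 1 * 64"
  proof (intro add_mono card_UN_bound)
    show "card (c - {v, w}) \<le> 1" "card (b - {u, w}) \<le> 1" "card (a - {u, v}) \<le> 1"
      using assms(6-8) a b c fin by (simp_all add: card_Diff_subset)
  next
    fix z assume "z \<in> c - {v, w}"
    then have "u \<noteq> z" using c by auto
    then have "card {u, z} = 2" by simp
    then show "card (X {u, z}) \<le> 16" using X[of "{u, z}"] by simp
  next
    fix z assume "z \<in> b - {u, w}"
    then have "v \<noteq> z" using b by auto
    then have "card {v, z} = 2" by simp
    then show "card (X {v, z}) \<le> 16" using X[of "{v, z}"] by simp
  next
    fix z assume "z \<in> a - {u, v}"
    show "card (X {z}) \<le> 64" using X[of "{z}"] by simp
  qed (use fin in auto)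
  finally show ?thesis by simp
qed

text \<open>Such an \<open>F\<close> meets \<open>G\<close> in a point outside
  \<open>{u, v}\<close>, so it contains one of at most \<open>k\<close> triples
  \<open>{u, v, z}\<close>.\<close>

lemma card_containing_pair_le:
  assumes "\<F> \<subseteq> [{1..n}]\<^bsup>k\<^esup>" "intersecting \<F>" "G \<in> \<F>" "u \<notin> G" "v \<notin> G" "u \<noteq> v"
    and "{u, v, w} \<subseteq> {1..n}"
  shows "real (card {F\<in>\<F>. w \<notin> F \<and> {u, v} \<subseteq> F}) \<le> real k * num_ext n k 3"
proof -
  have G: "G \<subseteq> {1..n}" "card G = k" "finite G"
    using assms(1,3) by (auto simp: nsets_def)
  have "{F\<in>\<F>. w \<notin> F \<and> {u, v} \<subseteq> F} \<subseteq> {F\<in>\<F>. w \<notin> F \<and> (\<exists>t\<in>(\<lambda>z. {u, v, z}) ` G. t \<subseteq> F)}"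
  proof
    fix F assume F: "F \<in> {F\<in>\<F>. w \<notin> F \<and> {u, v} \<subseteq> F}"
    then have "F \<inter> G \<noteq> {}"
      using assms(2,3) by (simp add: intersecting_def)
    then obtain z where "z \<in> F" "z \<in> G" by blast
    with F show "F \<in> {F\<in>\<F>. w \<notin> F \<and> (\<exists>t\<in>(\<lambda>z. {u, v, z}) ` G. t \<subseteq> F)}" by auto
  qed
  moreover have "finite \<F>"
    using assms(1) by (rule finite_subset) (auto intro: finite_imp_finite_nsets)
  ultimately have "card {F\<in>\<F>. w \<notin> F \<and> {u, v} \<subseteq> F}
      \<le> card {F\<in>\<F>. w \<notin> F \<and> (\<exists>t\<in>(\<lambda>z. {u, v, z}) ` G. t \<subseteq> F)}"
    by (intro card_mono) auto
  moreover have "real (card {F\<in>\<F>. w \<notin> F \<and> (\<exists>t\<in>(\<lambda>z. {u, v, z}) ` G. t \<subseteq> F)})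
      \<le> real k * num_ext n k 3"
  proof (rule card_covered_le[OF assms(1)])
    show "card ((\<lambda>z. {u, v, z}) ` G) \<le> k"
      using card_image_le[OF G(3)] G(2) by metis
    fix t assume "t \<in> (\<lambda>z. {u, v, z}) ` G"
    then show "card t = 3" using assms(4-6) by (auto simp: card_insert_if)
  qed (use G(1) assms(7) in auto)
  ultimately show ?thesis by linarith
qed

text \<open>\<open>B5\<close>, \<open>B4\<close>, \<open>B3\<close> are the critical families of
  successive peeling stages. A member of \<F> avoiding \<open>w\<close> but not containing
  \<open>{u, v}\<close> contains no edge of the triangle, and such a set is lost at size 4 at the
  latest: size 3 contributes nothing, and at size 4 only sets with at most one vertex count.\<close>

lemma card_avoiding_triangle_vertex_le:
  assumes "\<F> \<subseteq> [{1..n}]\<^bsup>k\<^esup>" "intersecting \<F>"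
    and B5: "B5 \<subseteq> Pow {1..n}" "intersecting B5" "critical B5" "\<And>t. t \<in> T5 \<Longrightarrow> \<exists>b\<in>B5. b \<subseteq> t"
      "\<And>b. b \<in> B5 \<Longrightarrow> card b \<le> 5"
    and B4: "B4 \<subseteq> Pow {1..n}" "intersecting B4" "critical B4"
      "\<And>t. t \<in> B5 \<Longrightarrow> card t \<noteq> 5 \<Longrightarrow> \<exists>b\<in>B4. b \<subseteq> t"
      "\<And>b. b \<in> B4 \<Longrightarrow> \<exists>t\<in>B5. card t \<noteq> 5 \<and> b \<subseteq> t" "\<And>b. b \<in> B4 \<Longrightarrow> card b \<le> 4"
    and B3: "intersecting B3" "\<And>t. t \<in> B4 \<Longrightarrow> card t \<noteq> 4 \<Longrightarrow> \<exists>b\<in>B3. b \<subseteq> t"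
      "\<And>b. b \<in> B3 \<Longrightarrow> \<exists>t\<in>B4. card t \<noteq> 4 \<and> b \<subseteq> t \<and> (\<forall>b'\<in>B3. b' \<subseteq> t \<longrightarrow> b' = b)"
    and triangle: "{u, v} \<in> B3" "{u, w} \<in> B3" "{v, w} \<in> B3" "u \<noteq> v" "u \<noteq> w" "v \<noteq> w"
      "{u, v, w} \<subseteq> {1..n}"
    and G: "G \<in> \<F>" "u \<notin> G" "v \<notin> G"
  shows "real (card {F\<in>\<F>. w \<notin> F}) \<le> real k * num_ext n k 3 + 96 * num_ext n k 4
    + 2500 * num_ext n k 5 + real (card (uncovered \<F> T5 w))"
proof -
  let ?W5 = "{b\<in>B5. card b = 5}"
    and ?W4 = "{b\<in>B4. card b = 4 \<and> card (b \<inter> {u, v, w}) \<le> 1}"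
  have finF: "finite \<F>"
    using assms(1) by (rule finite_subset) (auto intro: finite_imp_finite_nsets)
  have fin5: "finite B5" "\<And>b. b \<in> B5 \<Longrightarrow> finite b"
    using B5(1) by (auto intro: finite_subset dest: finite_subset[of B5 "Pow {1..n}"])
  have fin4: "finite B4" "\<And>b. b \<in> B4 \<Longrightarrow> finite b"
    using B4(1) by (auto intro: finite_subset dest: finite_subset[of B4 "Pow {1..n}"])
  \<comment> \<open>The witness of the edge \<open>{x, y}\<close> contains no other member of
    \<open>B3\<close>. If it contained \<open>z\<close>, it would contain the edge
    \<open>{x, z}\<close>.\<close>
  have isolate: "\<exists>t\<in>B4. card t \<le> 3 \<and> {x, y} \<subseteq> t \<and> z \<notin> t"
    if "{x, y} \<in> B3" "{x, z} \<in> B3" "z \<noteq> y" for x y z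
  proof -
    obtain t where t: "t \<in> B4" "card t \<noteq> 4" "{x, y} \<subseteq> t" "\<forall>b'\<in>B3. b' \<subseteq> t \<longrightarrow> b' = {x, y}"
      using B3(3)[OF \<open>{x, y} \<in> B3\<close>] by blast
    then have "z \<notin> t" using that by (metis doubleton_eq_iff insert_subset)
    then show ?thesis using t B4(6)[OF t(1)] by (intro bexI[of _ t]) auto
  qed
  have "card ?W4 \<le> 96"
  proof -
    obtain a where "a \<in> B4" "card a \<le> 3" "{u, v} \<subseteq> a" "w \<notin> a"
      using isolate[of u v w] triangle by blast
    moreover obtain b where "b \<in> B4" "card b \<le> 3" "{u, w} \<subseteq> b" "v \<notin> b"
      using isolate[of u w v] triangle by blast
    moreover obtain c where "c \<in> B4" "card c \<le> 3" "{v, w} \<subseteq> c" "u \<notin> c"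
      using isolate[of v w u] triangle by (auto simp: insert_commute)
    ultimately show ?thesis
      by (intro card_critical_4_pair_free[OF fin4 B4(6,2,3) triangle(4-6)])
  qed
  then have W4: "real (card {F\<in>\<F>. w \<notin> F \<and> (\<exists>t\<in>?W4. t \<subseteq> F)}) \<le> real 96 * num_ext n k 4"
    using B4(1) triangle(7) by (intro card_covered_le[OF assms(1)]) auto
  \<comment> \<open>A member of \<open>B5\<close> of size at most 4 exists, and all members of size
    5 meet it: \<open>4 * 5 ^ 4 = 2500\<close> instead of \<open>5 ^ 5\<close>.\<close>
  obtain b4 where "b4 \<in> B4" using isolate[OF triangle(1,2)] triangle(6) by auto
  then obtain c where c: "c \<in> B5" "card c \<noteq> 5" using B4(5) by blast
  have "card ?W5 \<le> card c * 5 ^ (5 - 1)"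
    by (rule card_critical_meeting[OF fin5 B5(5,2,3) c(1)]) auto
  also have "\<dots> \<le> 4 * 625"
    using B5(5)[OF c(1)] c(2) by simp
  finally have "card ?W5 \<le> 2500" by simp
  then have W5: "real (card {F\<in>\<F>. w \<notin> F \<and> (\<exists>t\<in>?W5. t \<subseteq> F)}) \<le> real 2500 * num_ext n k 5"
    using B5(1) triangle(7) by (intro card_covered_le[OF assms(1)]) auto
  let ?P = "{F\<in>\<F>. w \<notin> F \<and> {u, v} \<subseteq> F}" and ?P4 = "{F\<in>\<F>. w \<notin> F \<and> (\<exists>t\<in>?W4. t \<subseteq> F)}"
    and ?P5 = "{F\<in>\<F>. w \<notin> F \<and> (\<exists>t\<in>?W5. t \<subseteq> F)}"
  have "{F\<in>\<F>. w \<notin> F} \<subseteq> ?P \<union> ?P4 \<union> ?P5 \<union> uncovered \<F> T5 w"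
  proof
    fix F assume F: "F \<in> {F\<in>\<F>. w \<notin> F}"
    have P4: "F \<in> ?P4" if uv: "\<not> {u, v} \<subseteq> F" and b4: "b4 \<in> B4" "b4 \<subseteq> F" for b4
    proof -
      have free: "\<not> {u, v} \<subseteq> F" "\<not> {u, w} \<subseteq> F" "\<not> {v, w} \<subseteq> F"
        using uv F by auto
      have "card b4 = 4"
      proof (rule ccontr)
        assume "card b4 \<noteq> 4"
        \<comment> \<open>As \<open>b3\<close> meets all three edges, it contains two vertices, so
          \<open>F\<close> would contain an edge.\<close>
        then obtain b3 where b3: "b3 \<in> B3" "b3 \<subseteq> b4" using B3(2) b4(1) by blast
        then have "b3 \<inter> {u, v} \<noteq> {}" "b3 \<inter> {u, w} \<noteq> {}" "b3 \<inter> {v, w} \<noteq> {}"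
          using B3(1) triangle(1-3) unfolding intersecting_def by auto
        with b3(2) b4(2) free show False by blast
      qed
      moreover have "card (b4 \<inter> {u, v, w}) \<le> 1"
        using card_Int_three_ge_2_iff[OF triangle(4-6), of b4] free b4(2) by fastforce
      ultimately show ?thesis using F b4 by blast
    qed
    have P5: "F \<in> ?P5 \<or> (\<exists>b4\<in>B4. b4 \<subseteq> F)" if b5: "b5 \<in> B5" "b5 \<subseteq> F" for b5
      using F b5 B4(4)[of b5] by blast
    have unc: "F \<in> uncovered \<F> T5 w \<or> (\<exists>b5\<in>B5. b5 \<subseteq> F)"
    proof (cases "\<exists>t\<in>T5. t \<subseteq> F")
      case True
      then obtain t where "t \<in> T5" "t \<subseteq> F" by auto
      with B5(4)[of t] show ?thesis by (meson subset_trans)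
    next
      case False
      with F show ?thesis by (simp add: uncovered_def)
    qed
    show "F \<in> ?P \<union> ?P4 \<union> ?P5 \<union> uncovered \<F> T5 w"
    proof (cases "{u, v} \<subseteq> F \<or> F \<in> uncovered \<F> T5 w")
      case True
      with F show ?thesis by auto
    next
      case False
      with unc obtain b5 where "b5 \<in> B5" "b5 \<subseteq> F" by auto
      then have "F \<in> ?P5 \<or> F \<in> ?P4"
        using P5[of b5] P4 False by auto
      then show ?thesis by (elim disjE) simp_all
    qed
  qed
  then have "card {F\<in>\<F>. w \<notin> F} \<le> card (?P \<union> ?P4 \<union> ?P5 \<union> uncovered \<F> T5 w)"
    using finF by (intro card_mono) (auto simp: uncovered_def)
  also have "\<dots> \<le> card ?P + card ?P4 + card ?P5 + card (uncovered \<F> T5 w)"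
    by (meson add_right_mono card_Un_le le_trans)
  finally have "real (card {F\<in>\<F>. w \<notin> F})
      \<le> real (card ?P) + real (card ?P4) + real (card ?P5) + real (card (uncovered \<F> T5 w))"
    by linarith
  moreover have "real (card ?P) \<le> real k * num_ext n k 3"
    by (rule card_containing_pair_le[OF assms(1,2) G triangle(4,7)])
  ultimately show ?thesis using W4 W5 by simp
qed

text \<open>The two parts of the maximum serve different purposes: the bound with 40 rules out a
  star among the remaining pairs, and the bound with \<open>k + 4\<close> rules out a member of \<F>
  missing two vertices of the triangle.\<close>

lemma obtain_triangle:
  assumes "k \<ge> 2" "\<F> \<subseteq> [{1..n}]\<^bsup>k\<^esup>" "intersecting \<F>" "40 * k \<le> n" "k * (k + 4) \<le> n"
    and avoiding: "\<And>x. x \<in> {1..n} \<Longrightarrow> real (max (k + 4) 40)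
      * (real k / real n * real ((n - 3) choose (k - 2))) \<le> real (card {F\<in>\<F>. x \<notin> F})"
  obtains u v w where "u \<noteq> v" "u \<noteq> w" "v \<noteq> w" "{u, v, w} \<subseteq> {1..n}"
    "\<And>F. F \<in> \<F> \<Longrightarrow> card (F \<inter> {u, v, w}) \<ge> 2"
proof -
  define U where "U = real k / real n * real ((n - 3) choose (k - 2))"
  have U: "U \<ge> 0" by (simp add: U_def)
  define L where "L = (\<Sum>s=6..k + 8. real s ^ s * num_ext n k s)"
  \<comment> \<open>The last three stages are carried out one by one, since the triangle case needs
    the critical families themselves.\<close>
  obtain T5 where T5: "T5 \<subseteq> Pow {1..n}" "intersecting T5" "\<And>t. t \<in> T5 \<Longrightarrow> card t \<le> 5"
    and unc5: "\<And>x. x \<in> {1..n} \<Longrightarrow> real (card (uncovered \<F> T5 x)) \<le> L"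
    using peel[OF assms(2,3), of 5] unfolding L_def by auto
  obtain B5 where B5: "B5 \<subseteq> Pow {1..n}" "intersecting B5" "critical B5"
      "\<And>t. t \<in> T5 \<Longrightarrow> \<exists>b\<in>B5. b \<subseteq> t" "\<And>b. b \<in> B5 \<Longrightarrow> card b \<le> 5"
    and unc4: "\<And>x. x \<in> {1..n} \<Longrightarrow> real (card (uncovered \<F> {b\<in>B5. card b \<noteq> 5} x))
      \<le> real (card (uncovered \<F> T5 x)) + real 5 ^ 5 * num_ext n k 5"
    by (rule peel_step[OF assms(2) T5(1,2), where s = 5]) (erule T5(3), rule that)
  have T4: "{b\<in>B5. card b \<noteq> 5} \<subseteq> Pow {1..n}" "intersecting {b\<in>B5. card b \<noteq> 5}"
    "\<And>t. t \<in> {b\<in>B5. card b \<noteq> 5} \<Longrightarrow> card t \<le> 4"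
    using B5(1,2) B5(5) unfolding intersecting_def by (auto, force)
  obtain B4 where B4: "B4 \<subseteq> Pow {1..n}" "intersecting B4" "critical B4"
      "\<And>t. t \<in> {b\<in>B5. card b \<noteq> 5} \<Longrightarrow> \<exists>b\<in>B4. b \<subseteq> t"
      "\<And>b. b \<in> B4 \<Longrightarrow> \<exists>t\<in>{b\<in>B5. card b \<noteq> 5}. b \<subseteq> t \<and> (\<forall>b'\<in>B4. b' \<subseteq> t \<longrightarrow> b' = b)"
      "\<And>b. b \<in> B4 \<Longrightarrow> card b \<le> 4"
    and unc3: "\<And>x. x \<in> {1..n} \<Longrightarrow> real (card (uncovered \<F> {b\<in>B4. card b \<noteq> 4} x))
      \<le> real (card (uncovered \<F> {b\<in>B5. card b \<noteq> 5} x)) + real 4 ^ 4 * num_ext n k 4"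
    by (rule peel_step[OF assms(2) T4(1,2), where s = 4]) (erule T4(3), rule that)
  have T3: "{b\<in>B4. card b \<noteq> 4} \<subseteq> Pow {1..n}" "intersecting {b\<in>B4. card b \<noteq> 4}"
    "\<And>t. t \<in> {b\<in>B4. card b \<noteq> 4} \<Longrightarrow> card t \<le> 3"
    using B4(1,2) B4(6) unfolding intersecting_def by (auto, force)
  obtain B3 where B3: "B3 \<subseteq> Pow {1..n}" "intersecting B3"
      "\<And>t. t \<in> {b\<in>B4. card b \<noteq> 4} \<Longrightarrow> \<exists>b\<in>B3. b \<subseteq> t"
      "\<And>b. b \<in> B3 \<Longrightarrow> \<exists>t\<in>{b\<in>B4. card b \<noteq> 4}. b \<subseteq> t \<and> (\<forall>b'\<in>B3. b' \<subseteq> t \<longrightarrow> b' = b)"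
      "\<And>b. b \<in> B3 \<Longrightarrow> card b \<le> 3"
    and unc2: "\<And>x. x \<in> {1..n} \<Longrightarrow> real (card (uncovered \<F> {b\<in>B3. card b \<noteq> 3} x))
      \<le> real (card (uncovered \<F> {b\<in>B4. card b \<noteq> 4} x)) + real 3 ^ 3 * num_ext n k 3"
    by (rule peel_step[OF assms(2) T3(1,2), where s = 3]) (erule T3(3), rule that)
  let ?T2 = "{b\<in>B3. card b \<noteq> 3}"
  have T2: "intersecting ?T2" "\<forall>t\<in>?T2. finite t \<and> card t \<le> 2"
    using B3(1,2) B3(5) unfolding intersecting_def by (auto intro: finite_subset, force)
  \<comment> \<open>If \<open>x\<close> lay in all of \<open>?T2\<close>, every member of \<F>
    avoiding \<open>x\<close> would be lost, but fewer than \<open>40 * U\<close> are. This also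
    excludes an empty \<open>?T2\<close>.\<close>
  have no_centre: "\<exists>t\<in>?T2. x \<notin> t" if x: "x \<in> {1..n}" for x
  proof (rule ccontr)
    assume "\<not> ?thesis"
    then have "uncovered \<F> ?T2 x = {F\<in>\<F>. x \<notin> F}"
      unfolding uncovered_def by blast
    moreover have "40 * U \<le> real (max (k + 4) 40) * U"
      using U by (intro mult_right_mono) auto
    ultimately have "40 * U \<le> real (card (uncovered \<F> ?T2 x))"
      using avoiding[OF x] unfolding U_def by simp
    moreover have "(\<Sum>s=3..k + 8. real s ^ s * num_ext n k s)
      = real 3 ^ 3 * num_ext n k 3 + real 4 ^ 4 * num_ext n k 4 + real 5 ^ 5 * num_ext n k 5 + L"
      by (simp add: L_def sum.atLeast_Suc_atMost[of 3] sum.atLeast_Suc_atMost[of 4]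
          sum.atLeast_Suc_atMost[of 5])
    ultimately show False
      using unc5[OF x] unc4[OF x] unc3[OF x] unc2[OF x]
        weighted_num_ext_bounds(1)[OF assms(1,4,5)] unfolding U_def by linarith
  qed
  have "1 \<in> {1..n}" using assms(1,4) by simp
  then have "?T2 \<noteq> {}" using no_centre by blast
  then have "(\<exists>x\<in>\<Union>?T2. \<forall>t\<in>?T2. x \<in> t) \<or> (\<exists>u v w. u \<noteq> v \<and> u \<noteq> w \<and> v \<noteq> w \<and>
      {u, v} \<in> ?T2 \<and> {u, w} \<in> ?T2 \<and> {v, w} \<in> ?T2)"
    by (rule intersecting_pairs[OF T2])
  moreover have "\<not> (\<exists>x\<in>\<Union>?T2. \<forall>t\<in>?T2. x \<in> t)"
  proof
    assume "\<exists>x\<in>\<Union>?T2. \<forall>t\<in>?T2. x \<in> t"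
    then obtain x where x: "x \<in> \<Union>?T2" "\<forall>t\<in>?T2. x \<in> t" by auto
    then have "x \<in> {1..n}" using B3(1) by blast
    with no_centre x(2) show False by blast
  qed
  ultimately have "\<exists>u v w. u \<noteq> v \<and> u \<noteq> w \<and> v \<noteq> w \<and>
      {u, v} \<in> ?T2 \<and> {u, w} \<in> ?T2 \<and> {v, w} \<in> ?T2"
    by (elim disjE) (erule (1) notE, assumption)
  then obtain u v w where "u \<noteq> v" "u \<noteq> w" "v \<noteq> w"
    "{u, v} \<in> ?T2" "{u, w} \<in> ?T2" "{v, w} \<in> ?T2"
    by (elim exE conjE) (rule that)
  then have uvw: "u \<noteq> v" "u \<noteq> w" "v \<noteq> w" "{u, v} \<in> B3" "{u, w} \<in> B3" "{v, w} \<in> B3"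
    by simp_all
  have B4': "\<exists>t\<in>B5. card t \<noteq> 5 \<and> b \<subseteq> t" if "b \<in> B4" for b
    using B4(5)[OF that] by auto
  have B3': "\<exists>t\<in>B4. card t \<noteq> 4 \<and> b \<subseteq> t \<and> (\<forall>b'\<in>B3. b' \<subseteq> t \<longrightarrow> b' = b)"
    if "b \<in> B3" for b
    using B3(4)[OF that] by auto
  \<comment> \<open>A member \<open>G\<close> missing \<open>x\<close> and \<open>y\<close> would
    leave fewer than \<open>(k + 4) * U\<close> members avoiding the third vertex
    \<open>z\<close>.\<close>
  have few: False if tri: "{x, y} \<in> B3" "{x, z} \<in> B3" "{y, z} \<in> B3" "x \<noteq> y" "x \<noteq> z" "y \<noteq> z"
    and G: "G \<in> \<F>" "x \<notin> G" "y \<notin> G" for x y z G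
  proof -
    have V: "{x, y, z} \<subseteq> {1..n}" using B3(1) tri(1,2) by blast
    have "real (card {F\<in>\<F>. z \<notin> F}) \<le> real k * num_ext n k 3 + 96 * num_ext n k 4
        + 2500 * num_ext n k 5 + real (card (uncovered \<F> T5 z))"
      using B4(4) B3(3)
      by (intro card_avoiding_triangle_vertex_le[OF assms(2,3) B5 B4(1-3) _ B4' B4(6) B3(2) _ B3'
            tri V G]) simp_all
    moreover have "real (k + 4) * U \<le> real (max (k + 4) 40) * U"
      using U by (intro mult_right_mono) auto
    then have "real (k + 4) * U \<le> real (card {F\<in>\<F>. z \<notin> F})"
      using avoiding[of z] V unfolding U_def by auto
    ultimately show False
      using unc5[of z] V weighted_num_ext_bounds(2)[OF assms(1,4,5)]
      unfolding U_def L_def by simp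
  qed
  have "card (G \<inter> {u, v, w}) \<ge> 2" if G: "G \<in> \<F>" for G
  proof (rule ccontr)
    assume "\<not> ?thesis"
    then have "u \<notin> G \<and> v \<notin> G \<or> u \<notin> G \<and> w \<notin> G \<or> v \<notin> G \<and> w \<notin> G"
      using card_Int_three_ge_2_iff[OF uvw(1-3), of G] by auto
    then show False
      using few[of u v w G] few[of u w v G] few[of v w u G] uvw G
      by (auto simp: insert_commute)
  qed
  moreover have "{u, v, w} \<subseteq> {1..n}" using B3(1) uvw(4,5) by blast
  ultimately show thesis using that uvw(1-3) by blast
qed

section \<open>Diversity\<close>

text \<open>The degree of \<open>x\<close> is the number of members containing \<open>x\<close>,
  because removing \<open>x\<close> is injective on them, and it is at most the maximum
  degree.\<close>

lemma diversity_le_card_avoiding: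
  assumes "\<F> \<subseteq> [{1..n}]\<^bsup>k\<^esup>" "x \<in> {1..n}"
  shows "diversity n \<F> \<le> int (card {F\<in>\<F>. x \<notin> F})"
proof -
  have fin: "finite \<F>"
    using assms(1) by (rule finite_subset) (auto intro: finite_imp_finite_nsets)
  have "link \<F> x = (\<lambda>F. F - {x}) ` {F\<in>\<F>. x \<in> F}"
    by (auto simp: link_def)
  moreover have "inj_on (\<lambda>F. F - {x}) {F\<in>\<F>. x \<in> F}"
    by (auto simp: inj_on_def)
  ultimately have "card (link \<F> x) = card {F\<in>\<F>. x \<in> F}"
    by (simp add: card_image)
  moreover have "card (link \<F> x) \<le> max_degree n \<F>"
    unfolding max_degree_def using assms(2) by (intro Max_ge) auto
  moreover have "card \<F> = card {F\<in>\<F>. x \<in> F} + card {F\<in>\<F>. x \<notin> F}"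
    using fin by (subst card_Un_disjoint[symmetric]) (auto intro: arg_cong[where f = card])
  ultimately show ?thesis by (simp add: diversity_def)
qed

text \<open>All members avoiding \<open>w\<close> contain \<open>{u, v}\<close>, and they number at
  least the diversity; subtract this from the number of all \<open>k\<close>-sets with that
  trace.\<close>

lemma card_trace_complement_le:
  assumes "\<F> \<subseteq> [{1..n}]\<^bsup>k\<^esup>" "{u, v, w} \<subseteq> {1..n}" "u \<noteq> v" "u \<noteq> w" "v \<noteq> w" "k \<ge> 2"
    and "\<And>F. F \<in> \<F> \<Longrightarrow> card (F \<inter> {u, v, w}) \<ge> 2"
  shows "real (card {F\<in>[{1..n}]\<^bsup>k\<^esup>. {u, v} \<subseteq> F \<and> w \<notin> F \<and> F \<notin> \<F>})
    \<le> real ((n - 3) choose (k - 2)) - real_of_int (diversity n \<F>)"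
proof -
  let ?A = "{F\<in>[{1..n}]\<^bsup>k\<^esup>. {u, v} \<subseteq> F \<and> w \<notin> F}"
  have fin: "finite ?A" by (simp add: finite_imp_finite_nsets)
  have sub: "{F\<in>\<F>. w \<notin> F} \<subseteq> ?A"
    using assms(1,7) card_Int_three_ge_2_iff[OF assms(3-5)] by blast
  have "card {F\<in>[{1..n}]\<^bsup>k\<^esup>. {u, v} \<subseteq> F \<and> w \<notin> F \<and> F \<notin> \<F>} = card (?A - {F\<in>\<F>. w \<notin> F})"
    by (rule arg_cong[where f = card]) auto
  also have "\<dots> = card ?A - card {F\<in>\<F>. w \<notin> F}"
    using sub fin by (intro card_Diff_subset) (auto intro: finite_subset)
  finally have "real (card {F\<in>[{1..n}]\<^bsup>k\<^esup>. {u, v} \<subseteq> F \<and> w \<notin> F \<and> F \<notin> \<F>})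
      = real (card ?A) - real (card {F\<in>\<F>. w \<notin> F})"
    using card_mono[OF fin sub] by simp
  moreover have "card {u, v} = 2" using assms(3) by simp
  then have "real (card ?A) \<le> real ((n - 3) choose (k - 2))"
    using card_extensions[of "{u, v}" n w k] assms(2) num_ext_2[OF assms(6), of n] by force
  moreover have "diversity n \<F> \<le> int (card {F\<in>\<F>. w \<notin> F})"
    using assms(1,2) by (intro diversity_le_card_avoiding) auto
  then have "real_of_int (diversity n \<F>) \<le> real (card {F\<in>\<F>. w \<notin> F})"
    by linarith
  ultimately show ?thesis by linarith
qed

theorem corollary1p12:
  fixes n k :: nat and \<F> :: "nat set set" and \<alpha> :: real
  assumes "k \<ge> 2"
    and "\<F> \<subseteq> [{1..n}]\<^bsup>k\<^esup>"
    and "intersecting \<F>"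
    and "of_int (diversity n \<F>) = (1 - \<alpha>) * real ((n - 3) choose (k - 2))"
    and "0 \<le> \<alpha>" and "\<alpha> < 1"
    and "real n \<ge> real (max (k + 4) 40) * (real k / (1 - \<alpha>))"
  shows "\<exists>u\<in>{1..n}. \<exists>v\<in>{1..n}. \<exists>w\<in>{1..n}. u \<noteq> v \<and> u \<noteq> w \<and> v \<noteq> w \<and>
           \<F> \<subseteq> two_of_three_star n k u v w \<and>
           real (card (two_of_three n k u v w - \<F>)) \<le> 3 * \<alpha> * real ((n - 3) choose (k - 2))"
proof -
  let ?M = "max (k + 4) 40" and ?P = "real ((n - 3) choose (k - 2))"
  have scaled: "real ?M * real k \<le> real n * (1 - \<alpha>)"
    using assms(6,7) by (simp add: field_simps)
  also have "\<dots> \<le> real n"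
    using assms(5,6) by (simp add: mult_left_le)
  finally have "?M * k \<le> n"
    by (metis of_nat_le_iff of_nat_mult)
  then have "40 * k \<le> n" "(k + 4) * k \<le> n"
    by (rule le_trans[rotated], intro mult_right_mono; simp)+
  then have large: "40 * k \<le> n" "k * (k + 4) \<le> n"
    by (simp_all add: mult.commute)
  then have "n > 0" using assms(1) by simp
  \<comment> \<open>The size condition on \<open>n\<close> in the form that turns the prescribed
    diversity into the lower bound required by \<open>obtain_triangle\<close>.\<close>
  then have density: "real ?M * (real k / real n) \<le> 1 - \<alpha>"
    using scaled by (simp add: field_simps)
  have avoiding: "real ?M * (real k / real n * ?P) \<le> real (card {F\<in>\<F>. x \<notin> F})"
    if "x \<in> {1..n}" for x
  proof -
    have "real ?M * (real k / real n) * ?P \<le> (1 - \<alpha>) * ?P"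
      using density by (intro mult_right_mono) auto
    moreover have "diversity n \<F> \<le> int (card {F\<in>\<F>. x \<notin> F})"
      by (rule diversity_le_card_avoiding[OF assms(2) that])
    then have "real_of_int (diversity n \<F>) \<le> real (card {F\<in>\<F>. x \<notin> F})"
      by linarith
    ultimately show ?thesis using assms(4) by (simp add: mult.assoc)
  qed
  obtain u v w where uvw: "u \<noteq> v" "u \<noteq> w" "v \<noteq> w" "{u, v, w} \<subseteq> {1..n}"
    and star: "\<And>F. F \<in> \<F> \<Longrightarrow> card (F \<inter> {u, v, w}) \<ge> 2"
    using obtain_triangle[OF assms(1-3) large avoiding] by blast
  \<comment> \<open>The sets of \<open>two_of_three\<close> outside \<F> are split by the two
    vertices they contain; each of the three classes has at most \<open>\<alpha> * ?P\<close>
    sets.\<close>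
  define miss where "miss a b c = {F\<in>[{1..n}]\<^bsup>k\<^esup>. {a, b} \<subseteq> F \<and> c \<notin> F \<and> F \<notin> \<F>}" for a b c
  have miss: "real (card (miss a b c)) \<le> \<alpha> * ?P"
    if "{a, b, c} = {u, v, w}" "a \<noteq> b" "a \<noteq> c" "b \<noteq> c" for a b c
    using card_trace_complement_le[OF assms(2), of a b c] that uvw(4) assms(1,4) star
    by (simp add: miss_def algebra_simps)
  have "two_of_three n k u v w - \<F> \<subseteq> miss u v w \<union> miss u w v \<union> miss v w u"
  proof
    fix F assume F: "F \<in> two_of_three n k u v w - \<F>"
    then have "\<not> {u, v, w} \<subseteq> F"
      using uvw(1-3) by (auto simp: two_of_three_def Int_absorb1)
    moreover have "{u, v} \<subseteq> F \<or> {u, w} \<subseteq> F \<or> {v, w} \<subseteq> F"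
      using F card_Int_three_ge_2_iff[OF uvw(1-3), of F] by (auto simp: two_of_three_def)
    ultimately show "F \<in> miss u v w \<union> miss u w v \<union> miss v w u"
      using F by (auto simp: two_of_three_def miss_def)
  qed
  moreover have "finite (miss a b c)" for a b c
    by (simp add: miss_def finite_imp_finite_nsets)
  ultimately have "card (two_of_three n k u v w - \<F>) \<le> card (miss u v w \<union> miss u w v \<union> miss v w u)"
    by (intro card_mono) auto
  also have "\<dots> \<le> card (miss u v w) + card (miss u w v) + card (miss v w u)"
    by (meson add_right_mono card_Un_le le_trans)
  finally have "real (card (two_of_three n k u v w - \<F>))
      \<le> real (card (miss u v w)) + real (card (miss u w v)) + real (card (miss v w u))"
    by linarith
  also have "\<dots> \<le> \<alpha> * ?P + \<alpha> * ?P + \<alpha> * ?P"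
    using uvw(1-3) by (intro add_mono miss) auto
  finally have "real (card (two_of_three n k u v w - \<F>)) \<le> 3 * \<alpha> * ?P"
    by simp
  moreover have "\<F> \<subseteq> two_of_three_star n k u v w"
    using assms(2) star by (auto simp: two_of_three_star_def)
  ultimately show ?thesis
    using uvw by (intro bexI[of _ u] bexI[of _ v] bexI[of _ w]) auto
qed

end
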